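(* There exists $N>0$ such that for all $n\ge N$ and all weights $b\ge 0$, $c>0$, the circle graph is never a Nash equilibrium of the payment network creation game with $n$ players; i.e., no strategy combination $s$ with $G[s]$ a cycle through all $n$ players is a Nash equilibrium.
   Context: Payment network creation game. There are $n$ players $[n]=\{0,1,\dots,n-1\}$. A strategy of player $u$ is a set $s_u\subseteq [n]\setminus\{u\}$ (the players to whom $u$ opens a channel). A strategy combination is $s=(s_0,\dots,s_{n-1})$, and $G[s]$ is the undirected simple graph on $[n]$ in which $u,v$ are adjacent iff $v\in s_u$ or $u\in s_v$. With weights $b\ge 0$ and $c>0$, the cost of $u$ is $$\mathrm{cost}_u(s)=|s_u|+b\cdot \mathrm{betweenness}_u(s)+c\cdot \mathrm{closeness}_u(s),$$ $$\mathrm{betweenness}_u(s)=(n-1)(n-2)-\sum_{\substack{(i,j)\in[n]^2:\ i\ne j,\ i\neq u,\ j\ne u,\\ m(i,j)>0}}\frac{m_u(i,j)}{m(i,j)},\qquad \mathrm{closeness}_u(s)=\sum_{v\in[n]\setminus\{u\}}\bigl(d_{G[s]}(u,v)-1\bigr).$$ The sum in the betweenness runs over ordered pairs; $m(i,j)$ is the number of shortest paths between $i$ and $j$ in $G[s]$ and $m_u(i,j)$ the number of those passing through $u$; $d_{G[s]}$ is graph distance, equal to $\infty$ between different components. A strategy combination $s$ is a Nash equilibrium if no player can strictly decrease her cost by unilaterally changing her strategy. *)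

theory Defs
  imports Complex_Main "Graph_Theory.Pair_Digraph" "Graph_Theory.Shortest_Path"
begin

text \<open>A combination \<open>s\<close> assigns to every player \<open>u < n\<close> the set \<open>s u\<close>; its values at arguments
  \<open>u \<ge> n\<close> are never used.\<close>

definition strategies :: "nat \<Rightarrow> nat \<Rightarrow> nat set set" where
  "strategies n u = Pow ({..<n} - {u})"

definition strategy_combination :: "nat \<Rightarrow> (nat \<Rightarrow> nat set) \<Rightarrow> bool" where
  "strategy_combination n s \<longleftrightarrow> (\<forall>u<n. s u \<in> strategies n u)"

text \<open>Undirected simple graphs are represented as symmetric, loop-free digraphs without parallel
  arcs (locale \<open>pair_graph\<close>): an edge between \<open>u\<close> and \<open>v\<close> is the pair of arcs \<open>(u, v)\<close>, \<open>(v, u)\<close>.\<close>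

definition network :: "nat \<Rightarrow> (nat \<Rightarrow> nat set) \<Rightarrow> nat pair_pre_digraph" where
  "network n s = \<lparr> pverts = {..<n},
     parcs = {(u, v). u < n \<and> v < n \<and> (v \<in> s u \<or> u \<in> s v)} \<rparr>"

lemma pair_graph_network:
  assumes "strategy_combination n s"
  shows "pair_graph (network n s)"
proof
  show "finite (parcs (network n s))"
    by (rule finite_subset[of _ "{..<n} \<times> {..<n}"]) (auto simp: network_def)
  show "fst e \<noteq> snd e" if "e \<in> parcs (network n s)" for e
    using that assms by (fastforce simp: network_def strategy_combination_def strategies_def)
  show "symmetric (with_proj (network n s))"
    by (auto simp: symmetric_def sym_def network_def)
qed (auto simp: network_def)

text \<open>The infimum of the lengths of all walks from \<open>u\<close> to \<open>v\<close>, which is \<open>\<infinity>\<close> if there are none.\<close>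

definition graph_dist :: "'a pair_pre_digraph \<Rightarrow> 'a \<Rightarrow> 'a \<Rightarrow> ereal" where
  "graph_dist G u v = wf_digraph.\<mu> (with_proj G) (\<lambda>_. 1) u v"

definition shortest_paths :: "'a pair_pre_digraph \<Rightarrow> 'a \<Rightarrow> 'a \<Rightarrow> ('a \<times> 'a) awalk set" where
  "shortest_paths G i j =
     {p. pre_digraph.apath (with_proj G) i p j \<and> ereal (real (length p)) = graph_dist G i j}"

definition shortest_paths_through ::
    "'a pair_pre_digraph \<Rightarrow> 'a \<Rightarrow> 'a \<Rightarrow> 'a \<Rightarrow> ('a \<times> 'a) awalk set" where
  "shortest_paths_through G u i j =
     {p \<in> shortest_paths G i j. u \<in> set (pre_digraph.awalk_verts (with_proj G) i p)}"

definition betweenness :: "nat \<Rightarrow> (nat \<Rightarrow> nat set) \<Rightarrow> nat \<Rightarrow> real" where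
  "betweenness n s u =
     (real n - 1) * (real n - 2) -
     (\<Sum>(i, j) \<in> {(i, j). i < n \<and> j < n \<and> i \<noteq> j \<and> i \<noteq> u \<and> j \<noteq> u \<and>
                     card (shortest_paths (network n s) i j) > 0}.
        real (card (shortest_paths_through (network n s) u i j)) /
        real (card (shortest_paths (network n s) i j)))"

definition closeness :: "nat \<Rightarrow> (nat \<Rightarrow> nat set) \<Rightarrow> nat \<Rightarrow> ereal" where
  "closeness n s u = (\<Sum>v \<in> {..<n} - {u}. graph_dist (network n s) u v - 1)"

definition cost :: "nat \<Rightarrow> real \<Rightarrow> real \<Rightarrow> (nat \<Rightarrow> nat set) \<Rightarrow> nat \<Rightarrow> ereal" where
  "cost n b c s u =
     ereal (real (card (s u)) + b * betweenness n s u) + ereal c * closeness n s u"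

definition nash_equilibrium :: "nat \<Rightarrow> real \<Rightarrow> real \<Rightarrow> (nat \<Rightarrow> nat set) \<Rightarrow> bool" where
  "nash_equilibrium n b c s \<longleftrightarrow>
     strategy_combination n s \<and>
     (\<forall>u<n. \<forall>t \<in> strategies n u. \<not> cost n b c (s(u := t)) u < cost n b c s u)"

text \<open>A simple cycle through all vertices needs at least three of them; without that condition the
  equation for the arcs would also admit a loop or a single edge.\<close>

definition circle_graph :: "'a pair_pre_digraph \<Rightarrow> bool" where
  "circle_graph G \<longleftrightarrow> (\<exists>n\<ge>3. \<exists>f. bij_betw f {..<n} (pverts G) \<and>
     parcs G = (\<Union>i<n. {(f i, f (Suc i mod n)), (f (Suc i mod n), f i)}))"

end

theory Submission
  imports Defs
begin

text \<open>Number the cycle \<open>0, \<dots>, n - 1\<close> so that player \<open>0\<close> pays for her edge to \<open>n - 1\<close>. If \<open>n - 1\<close> pays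
  for it too, player \<open>0\<close> saves \<open>1\<close> by dropping it. Otherwise she redirects it to \<open>n - 4\<close>, at the same
  price. The last four vertices now have distances \<open>1, 2, 3, 4\<close> instead of \<open>4, 3, 2, 1\<close>, and no
  other vertex gets farther away, while some get closer; so the closeness term drops strictly.
  The betweenness term does not grow: in the cycle, a shortest path between \<open>a\<close> and \<open>b\<close> can contain \<open>0\<close>
  only if \<open>2 * \<bar>a - b\<bar> \<ge> n\<close>; after the swap, every walk from \<open>a\<close> to \<open>b\<close> that avoids \<open>0\<close> still has length
  at least \<open>\<bar>a - b\<bar>\<close>, so \<open>0\<close> lies on all shortest paths as soon as the way through \<open>0\<close> is shorter than
  that, and there are at least as many such pairs. All lower bounds on walk lengths come from integer
  functions on the vertices that change by at most \<open>1\<close> along an arc, so no shortest paths are counted.\<close>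

text \<open>If \<open>i\<close> and \<open>j\<close> are not connected this is \<open>0 / 0 = 0\<close>, so sums of it need no side condition on \<open>m(i,j)\<close>.\<close>

definition pair_dependency :: "'a pair_pre_digraph \<Rightarrow> 'a \<Rightarrow> 'a \<Rightarrow> 'a \<Rightarrow> real" where
  "pair_dependency G u i j =
     real (card (shortest_paths_through G u i j)) / real (card (shortest_paths G i j))"

section \<open>Walk lengths and dependencies, bounded by potentials\<close>

context pair_graph
begin

lemma awalk_cost_one: "awalk_cost (\<lambda>_. 1) p = real (length p)"
  by (induction p) auto

lemma graph_dist_eq: "graph_dist G i j = (INF p\<in>{p. awalk i p j}. ereal (real (length p)))"
  by (simp add: graph_dist_def \<mu>_def awalk_cost_one)

lemma relpow_imp_awalk:
  assumes "(i, j) \<in> parcs G ^^ k" "i \<in> pverts G"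
  shows "\<exists>p. awalk i p j \<and> length p = k"
  using assms
proof (induction k arbitrary: i)
  case 0
  then show ?case by (auto simp: awalk_Nil_iff)
next
  case (Suc k)
  from Suc.prems(1) obtain x where x: "(i, x) \<in> parcs G" "(x, j) \<in> parcs G ^^ k"
    by (meson relpow_Suc_D2)
  from Suc.IH[OF x(2)] x(1) obtain p where "awalk x p j" "length p = k"
    using in_arcsD2 by blast
  with x(1) show ?case by (intro exI[of _ "(i, x) # p"]) (auto simp: awalk_Cons_iff)
qed

lemma graph_dist_le:
  assumes "(i, j) \<in> parcs G ^^ k" "i \<in> pverts G"
  shows "graph_dist G i j \<le> ereal (real k)"
proof -
  obtain p where "awalk i p j" "length p = k"
    using relpow_imp_awalk[OF assms] by blast
  then show ?thesis by (auto simp: graph_dist_eq intro: INF_lower2)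
qed

text \<open>The increments of \<open>\<phi>\<close> along the walk add up. The set \<open>A\<close>
  admits a potential that jumps at a vertex the walk avoids: \<open>UNIV\<close> serves for all
  walks, \<open>- {u}\<close> for those avoiding \<open>u\<close>.\<close>

lemma awalk_length_ge:
  fixes \<phi> :: "'a \<Rightarrow> int"
  assumes "awalk i p j" "set (pawalk_verts i p) \<subseteq> A"
    and "\<And>x y. (x, y) \<in> parcs G \<Longrightarrow> x \<in> A \<Longrightarrow> y \<in> A \<Longrightarrow> \<phi> y \<le> \<phi> x + 1"
  shows "\<phi> j - \<phi> i \<le> int (length p)"
  using assms(1,2)
proof (induction p arbitrary: i)
  case Nil
  then show ?case by (auto simp: awalk_Nil_iff)
next
  case (Cons e p)
  obtain x where e: "e = (i, x)" "(i, x) \<in> parcs G" "awalk x p j"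
    using Cons.prems(1) by (cases e) (auto simp: awalk_Cons_iff)
  have sub: "set (pawalk_verts x p) \<subseteq> A" "i \<in> A"
    using Cons.prems(2) e(1) by auto
  have "x \<in> set (pawalk_verts x p)"
    using hd_in_awalk_verts(1)[OF e(3)] by simp
  then have "\<phi> x \<le> \<phi> i + 1"
    using assms(3)[OF e(2)] sub by blast
  with Cons.IH[OF e(3) sub(1)] show ?case by simp
qed

lemma graph_dist_ge:
  fixes \<phi> :: "'a \<Rightarrow> int"
  assumes "\<And>x y. (x, y) \<in> parcs G \<Longrightarrow> \<phi> y \<le> \<phi> x + 1"
  shows "ereal (real_of_int (\<phi> j - \<phi> i)) \<le> graph_dist G i j"
  unfolding graph_dist_eq
proof (rule INF_greatest)
  fix p assume "p \<in> {p. awalk i p j}"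
  then have "\<phi> j - \<phi> i \<le> int (length p)"
    using awalk_length_ge[of i p j UNIV \<phi>] assms by auto
  then show "ereal (real_of_int (\<phi> j - \<phi> i)) \<le> ereal (real (length p))"
    by simp
qed

lemma finite_shortest_paths: "finite (shortest_paths G i j)"
  by (rule finite_subset[OF _ apaths_finite[of i j]]) (auto simp: shortest_paths_def)

lemma shortest_pathsD:
  assumes "p \<in> shortest_paths G i j"
  shows "awalk i p j" "ereal (real (length p)) = graph_dist G i j"
  using assms by (auto simp: shortest_paths_def apath_def)

text \<open>The arc costs are nonnegative, so for a reachable vertex the infimum is attained by a
  path without repeated vertices.\<close>

lemma shortest_paths_nonempty:
  assumes "(i, j) \<in> parcs G ^^ k" "i \<in> pverts G"
  shows "shortest_paths G i j \<noteq> {}"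
proof -
  obtain p where "awalk i p j"
    using relpow_imp_awalk[OF assms] by blast
  then have "reachable (with_proj G) i j"
    by (auto simp: reachable_awalk)
  then obtain p where "apath i p j" "\<mu> (\<lambda>_. 1) i j = awalk_cost (\<lambda>_. 1) p"
    using min_cost_awalk[of i j "\<lambda>_. 1"] by auto
  then show ?thesis
    by (auto simp: shortest_paths_def graph_dist_def awalk_cost_one)
qed

lemma pair_dependency_le_1: "pair_dependency G u i j \<le> 1"
proof -
  have "card (shortest_paths_through G u i j) \<le> card (shortest_paths G i j)"
    by (rule card_mono[OF finite_shortest_paths]) (auto simp: shortest_paths_through_def)
  then show ?thesis
    by (cases "card (shortest_paths G i j) = 0") (auto simp: pair_dependency_def divide_le_eq_1)
qed

lemma pair_dependency_nonneg: "0 \<le> pair_dependency G u i j"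
  by (simp add: pair_dependency_def)

text \<open>A walk avoiding \<open>u\<close> has length at least \<open>\<phi> j - \<phi> i\<close>,
  hence more than \<open>k\<close>, and is too long to be shortest. On arcs touching
  \<open>u\<close> the potential may jump.\<close>

lemma pair_dependency_eq_1:
  fixes \<phi> :: "'a \<Rightarrow> int"
  assumes walk: "(i, j) \<in> parcs G ^^ k" "i \<in> pverts G"
    and lip: "\<And>x y. (x, y) \<in> parcs G \<Longrightarrow> x \<noteq> u \<Longrightarrow> y \<noteq> u \<Longrightarrow> \<phi> y \<le> \<phi> x + 1"
    and short: "int k < \<phi> j - \<phi> i"
  shows "pair_dependency G u i j = 1"
proof -
  have "u \<in> set (pawalk_verts i p)" if "p \<in> shortest_paths G i j" for p
  proof (rule ccontr)
    assume "u \<notin> set (pawalk_verts i p)"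
    then have "\<phi> j - \<phi> i \<le> int (length p)"
      using awalk_length_ge[of i p j "- {u}" \<phi>] shortest_pathsD[OF that] lip by auto
    moreover have "length p \<le> k"
      using shortest_pathsD(2)[OF that] graph_dist_le[OF walk] by (metis ereal_less_eq(3) of_nat_le_iff)
    ultimately show False using short by linarith
  qed
  then have "shortest_paths_through G u i j = shortest_paths G i j"
    by (auto simp: shortest_paths_through_def)
  \<comment> \<open>Without any shortest path the quotient would be \<open>0 / 0 = 0\<close> instead
    of \<open>1\<close>.\<close>
  moreover have "card (shortest_paths G i j) \<noteq> 0"
    using finite_shortest_paths shortest_paths_nonempty[OF walk] by simp
  ultimately show ?thesis by (simp add: pair_dependency_def)
qed

text \<open>A walk through \<open>u\<close> splits there into parts of lengths at least
  \<open>\<phi> i - \<phi> u\<close> and \<open>\<phi> j - \<phi> u\<close>, together more than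
  \<open>k\<close>.\<close>

lemma pair_dependency_eq_0:
  fixes \<phi> :: "'a \<Rightarrow> int"
  assumes walk: "(i, j) \<in> parcs G ^^ k" "i \<in> pverts G"
    and lip: "\<And>x y. (x, y) \<in> parcs G \<Longrightarrow> \<phi> y \<le> \<phi> x + 1"
    and long: "int k < (\<phi> i - \<phi> u) + (\<phi> j - \<phi> u)"
  shows "pair_dependency G u i j = 0"
proof -
  \<comment> \<open>Arcs come in both directions, so \<open>- \<phi>\<close> is a potential too; it
    bounds the part from \<open>i\<close> down to \<open>u\<close>.\<close>
  have lip': "- \<phi> y \<le> - \<phi> x + 1" if "(x, y) \<in> parcs G" for x y
    using lip[of y x] that pair_sym_arcs by (auto simp: symmetric_def sym_def)
  have "u \<notin> set (pawalk_verts i p)" if "p \<in> shortest_paths G i j" for p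
  proof
    assume "u \<in> set (pawalk_verts i p)"
    with awalk_decomp[OF shortest_pathsD(1)[OF that]]
    obtain q r where qr: "p = q @ r" "awalk i q u" "awalk u r j" by blast
    have "\<phi> i - \<phi> u \<le> int (length q)"
      using awalk_length_ge[OF qr(2), of UNIV "\<lambda>x. - \<phi> x"] lip' by auto
    moreover have "\<phi> j - \<phi> u \<le> int (length r)"
      using awalk_length_ge[OF qr(3), of UNIV \<phi>] lip by auto
    moreover have "length p \<le> k"
      using shortest_pathsD(2)[OF that] graph_dist_le[OF walk] by (metis ereal_less_eq(3) of_nat_le_iff)
    ultimately show False using long qr(1) by simp
  qed
  then have "shortest_paths_through G u i j = {}"
    by (auto simp: shortest_paths_through_def)
  then show ?thesis by (simp add: pair_dependency_def)
qed

end

section \<open>Walks along a numbering and costs in terms of positions\<close>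

lemma relpow_path:
  assumes "sym R" and step: "\<And>i. Suc i < n \<Longrightarrow> (g i, g (Suc i)) \<in> R" and "a < n" "b < n"
  shows "(g a, g b) \<in> R ^^ nat \<bar>int a - int b\<bar>"
proof -
  have up: "(g a, g (a + k)) \<in> R ^^ k \<and> (g (a + k), g a) \<in> R ^^ k" if "a + k < n" for a k
    using that
  proof (induction k)
    case (Suc k)
    have "(g (a + k), g (Suc (a + k))) \<in> R" "(g (Suc (a + k)), g (a + k)) \<in> R"
      using step[of "a + k"] Suc.prems \<open>sym R\<close> by (auto dest: symD)
    with Suc show ?case
      using relpow_Suc_I[of "g a" "g (a + k)" k R] relpow_Suc_I2[of "g (Suc (a + k))" "g (a + k)" R]
      by simp
  qed simp
  show ?thesis
  proof (cases "a \<le> b")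
    case True
    then show ?thesis using up[of a "b - a"] assms by (simp add: nat_diff_distrib)
  next
    case False
    then have "nat \<bar>int a - int b\<bar> = a - b" by linarith
    with False show ?thesis using up[of b "a - b"] assms by simp
  qed
qed

text \<open>Pulled back along a labelling \<open>g\<close>, these are the ordered pairs in the
  betweenness sum of player \<open>g 0\<close>.\<close>

definition inner_pairs :: "nat \<Rightarrow> (nat \<times> nat) set" where
  "inner_pairs n = {(a, b). a < n \<and> b < n \<and> a \<noteq> b \<and> a \<noteq> 0 \<and> b \<noteq> 0}"

lemma finite_inner_pairs: "finite (inner_pairs n)"
  by (rule finite_subset[of _ "{..<n} \<times> {..<n}"]) (auto simp: inner_pairs_def)

lemma betweenness_reindex:
  assumes g: "bij_betw g {..<n} {..<n}" and "0 < n"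
  shows "betweenness n s (g 0) = (real n - 1) * (real n - 2) -
    (\<Sum>(a, b)\<in>inner_pairs n. pair_dependency (network n s) (g 0) (g a) (g b))"
proof -
  let ?d = "\<lambda>(i, j). pair_dependency (network n s) (g 0) i j"
  let ?P = "{(i, j). i < n \<and> j < n \<and> i \<noteq> j \<and> i \<noteq> g 0 \<and> j \<noteq> g 0}"
  let ?S = "{(i, j). i < n \<and> j < n \<and> i \<noteq> j \<and> i \<noteq> g 0 \<and> j \<noteq> g 0 \<and>
                     card (shortest_paths (network n s) i j) > 0}"
  have fin: "finite ?P"
    by (rule finite_subset[of _ "{..<n} \<times> {..<n}"]) auto
  have "sum ?d ?S = sum ?d ?P"
    by (rule sum.mono_neutral_left[OF fin]) (auto simp: pair_dependency_def)
  also have "\<dots> = (\<Sum>x\<in>inner_pairs n. ?d (map_prod g g x))"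
  proof (rule sum.reindex_bij_betw[symmetric])
    have inj: "g a = g b \<longleftrightarrow> a = b" if "a < n" "b < n" for a b
      using g that by (auto simp: bij_betw_def inj_on_def)
    have img: "g a < n" if "a < n" for a
      using g that by (auto simp: bij_betw_def)
    have surj: "\<exists>a<n. x = g a" if "x < n" for x
      using g that by (auto simp: bij_betw_def image_iff)
    show "bij_betw (map_prod g g) (inner_pairs n) ?P"
      unfolding bij_betw_def
    proof
      show "inj_on (map_prod g g) (inner_pairs n)"
        by (auto simp: inj_on_def inner_pairs_def inj)
      show "map_prod g g ` inner_pairs n = ?P"
      proof (intro subset_antisym subsetI)
        fix x assume "x \<in> map_prod g g ` inner_pairs n"
        then show "x \<in> ?P" using \<open>0 < n\<close> by (auto simp: inner_pairs_def inj img)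
      next
        fix x assume "x \<in> ?P"
        then obtain i j where x: "x = (i, j)" "i < n" "j < n" "i \<noteq> j" "i \<noteq> g 0" "j \<noteq> g 0"
          by auto
        obtain a b where "a < n" "i = g a" "b < n" "j = g b"
          using surj x by metis
        with x have "x = map_prod g g (a, b)" "(a, b) \<in> inner_pairs n"
          by (auto simp: inner_pairs_def intro!: gr0I)
        then show "x \<in> map_prod g g ` inner_pairs n" by blast
      qed
    qed
  qed
  finally show ?thesis
    by (simp add: betweenness_def pair_dependency_def case_prod_unfold)
qed

lemma closeness_reindex:
  assumes g: "bij_betw g {..<n} {..<n}" and "0 < n"
  shows "closeness n s (g 0) = (\<Sum>j\<in>{1..<n}. graph_dist (network n s) (g 0) (g j) - 1)"
proof -
  have bij: "bij_betw g ({..<n} - {0}) ({..<n} - {g 0})"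
    using bij_betw_DiffI[OF g, of "{0}" "{g 0}"] \<open>0 < n\<close> g by (auto simp: bij_betw_def)
  have "{..<n} - {0} = {1..<n}" by auto
  then show ?thesis
    using sum.reindex_bij_betw[OF bij, of "\<lambda>v. graph_dist (network n s) (g 0) v - 1"]
    by (simp add: closeness_def)
qed

section \<open>Counting pairs and summing distances\<close>

lemma card_le_exchange:
  assumes "finite A" "finite B" "A - X \<subseteq> B" "Y \<subseteq> B" "A \<inter> Y = {}"
    and "finite X" "card X \<le> card Y"
  shows "card A \<le> card B"
proof -
  have "card A - card X \<le> card (A - X)"
    by (rule diff_card_le_card_Diff) fact
  moreover have "finite Y"
    using assms(2,4) finite_subset by blast
  then have "card (A - X) + card Y = card ((A - X) \<union> Y)"
    using assms(1,5) by (intro card_Un_disjoint[symmetric]) auto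
  moreover have "card ((A - X) \<union> Y) \<le> card B"
    by (rule card_mono) (use assms in auto)
  ultimately show ?thesis using assms(7) by linarith
qed

text \<open>The pairs on the left are those whose shortest paths in the cycle may run through \<open>0\<close>; for
  those on the right, the shortest paths after replacing the edge \<open>{0, n - 1}\<close> by \<open>{0, n - 4}\<close> all do.
  The right-hand set misses at most the six pairs \<open>X\<close> of the left-hand one, and gains the six
  pairs \<open>Y\<close>.\<close>

lemma card_inner_pairs_le:
  assumes "n \<ge> 20"
  shows "card {(a, b) \<in> inner_pairs n. int n \<le> 2 * \<bar>int a - int b\<bar>} \<le>
    card {(a, b) \<in> inner_pairs n.
      int (min a b) + 1 + \<bar>int (max a b) - int (n - 4)\<bar> < \<bar>int a - int b\<bar>}"
    (is "card ?O \<le> card ?N")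
proof -
  \<comment> \<open>Take \<open>a < b\<close>. For \<open>b = n - 1\<close> and
    \<open>b = n - 2\<close> the left-hand set allows \<open>a\<close> up to \<open>k - 1\<close>
    and \<open>k - 2\<close>, the right-hand one only up to \<open>k - 3\<close>; this gives
    \<open>?X\<close>. For \<open>b \<le> n - 4\<close> the right-hand condition is just
    \<open>n - 2 \<le> 2 * (b - a)\<close>. The largest difference with \<open>2 * h < n\<close>
    satisfies it but not the left-hand condition; this gives \<open>?Y\<close>.\<close>
  define k where "k = n div 2"
  define h where "h = (n - 1) div 2"
  let ?X = "{(k-2, n-1), (k-1, n-1), (k-2, n-2), (n-1, k-2), (n-1, k-1), (n-2, k-2)}"
  let ?Y = "{(1, 1+h), (2, 2+h), (3, 3+h), (1+h, 1), (2+h, 2), (3+h, 3)}"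
  have h: "n - 2 \<le> 2 * h" "2 * h < n" "9 \<le> h" and k: "n - 1 \<le> 2 * k" "2 * k \<le> n" "10 \<le> k"
    using assms by (auto simp: h_def k_def)
  have fin: "finite ?O" "finite ?N"
    by (auto intro: finite_subset[OF _ finite_inner_pairs[of n]])
  have missing: "?O - ?X \<subseteq> ?N"
  proof
    fix x assume "x \<in> ?O - ?X"
    then obtain a b where x: "x = (a, b)" "(a, b) \<in> ?O" "(a, b) \<notin> ?X"
      by (cases x) auto
    have ab: "0 < a" "a < n" "0 < b" "b < n" "int n \<le> 2 * \<bar>int a - int b\<bar>"
      using x(2) by (auto simp: inner_pairs_def)
    have key: "int a + 1 + \<bar>int b - int (n - 4)\<bar> < int b - int a"
      if "a < b" "b < n" "n \<le> 2 * (b - a)"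
        "\<not> (a = k-2 \<and> b = n-1)" "\<not> (a = k-1 \<and> b = n-1)" "\<not> (a = k-2 \<and> b = n-2)" for a b
    proof (cases "b < n - 4")
      case True
      then show ?thesis using that(1,3) assms by linarith
    next
      case False
      with \<open>b < n\<close> consider "b = n - 1" | "b = n - 2" | "b = n - 3 \<or> b = n - 4"
        by linarith
      \<comment> \<open>For each of the last four values of \<open>b\<close> the goal amounts to
        \<open>2 * a < n - 5\<close>, because \<open>b\<close> cancels.\<close>
      then have "a \<le> k - 3"
      proof cases
        case 1
        then have "a \<le> k - 1" using that(1,3) k by linarith
        moreover have "a \<noteq> k - 1" "a \<noteq> k - 2" using that(4,5) 1 by auto
        ultimately show ?thesis by linarith
      next
        case 2
        then have "a \<le> k - 2" using that(1,3) k by linarith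
        moreover have "a \<noteq> k - 2" using that(6) 2 by auto
        ultimately show ?thesis by linarith
      next
        case 3
        then show ?thesis using that(1,3) k by linarith
      qed
      then show ?thesis using False k assms by linarith
    qed
    have "int (min a b) + 1 + \<bar>int (max a b) - int (n - 4)\<bar> < \<bar>int a - int b\<bar>"
    proof (cases "a < b")
      case True
      then have "int n \<le> 2 * int (b - a)" using ab(5) by simp
      then have "n \<le> 2 * (b - a)" by linarith
      then have "int a + 1 + \<bar>int b - int (n - 4)\<bar> < int b - int a"
        by (rule key[OF True ab(4)]) (use x(3) in blast)+
      moreover have "min a b = a" "max a b = b"
        using True by simp_all
      ultimately show ?thesis by linarith
    next
      case False
      then have "int n \<le> 2 * int (a - b)" using ab(5) by simp
      then have "b < a" "n \<le> 2 * (a - b)" using assms by linarith+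
      from this(2) have "int b + 1 + \<bar>int a - int (n - 4)\<bar> < int a - int b"
        by (rule key[OF \<open>b < a\<close> ab(2)]) (use x(3) in blast)+
      moreover have "min a b = b" "max a b = a"
        using \<open>b < a\<close> by simp_all
      ultimately show ?thesis by linarith
    qed
    then show "x \<in> ?N"
      using x(1,2) by auto
  qed
  have gain: "?Y \<subseteq> ?N" "?O \<inter> ?Y = {}"
    using h assms by (auto simp: inner_pairs_def)
  have "card ?X \<le> 6"
    using card_length[of "[(k-2, n-1), (k-1, n-1), (k-2, n-2), (n-1, k-2), (n-1, k-1), (n-2, k-2)]"]
    by simp
  also have "6 = card ?Y"
    using h by simp
  finally have card: "card ?X \<le> card ?Y" .
  show ?thesis
    by (rule card_le_exchange[OF fin missing gain _ card]) simp
qed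

text \<open>The right-hand terms are distances from position \<open>0\<close> in the cycle, the
  left-hand ones lengths of walks along the path or over the new edge. The last four terms are
  merely permuted; for earlier positions \<open>1 + (n - 4 - j) < n - j\<close>.\<close>

lemma sum_cycle_distances_gt:
  assumes "n \<ge> 20"
  shows "(\<Sum>j\<in>{1..<n}. min (int j) (1 + \<bar>int j - int (n - 4)\<bar>)) <
    (\<Sum>j\<in>{1..<n}. min (int j) (int n - int j))"
    (is "sum ?l _ < sum ?m _")
proof -
  define m where "m = n - 4"
  have n: "n = m + 4" "16 \<le> m"
    using assms by (auto simp: m_def)
  have split: "{1..<n} = {1..<m} \<union> {m, m + 1, m + 2, m + 3}"
    using n by auto
  have "sum ?l {1..<m} < sum ?m {1..<m}"
  proof (rule sum_strict_mono_ex1)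
    show "\<forall>j\<in>{1..<m}. ?l j \<le> ?m j" using n by auto
    \<comment> \<open>The vertex just before the new neighbour improves from \<open>5\<close> to
      \<open>2\<close>.\<close>
    show "\<exists>j\<in>{1..<m}. ?l j < ?m j"
      using n by (intro bexI[of _ "m - 1"]) auto
  qed simp
  moreover have "sum ?l {m, m + 1, m + 2, m + 3} = sum ?m {m, m + 1, m + 2, m + 3}"
    using n by simp
  ultimately show ?thesis
    unfolding split by (subst (1 2) sum.union_disjoint) auto
qed

section \<open>Labellings of the cycle\<close>

definition cycle_adjacent :: "nat \<Rightarrow> nat \<Rightarrow> nat \<Rightarrow> bool" where
  "cycle_adjacent n a b \<longleftrightarrow> b = Suc a \<or> a = Suc b \<or> (a = 0 \<and> b = n - 1) \<or> (b = 0 \<and> a = n - 1)"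

text \<open>A labelling renames the players so that the deviating player gets position
  \<open>0\<close>.\<close>

definition cycle_labelling :: "nat \<Rightarrow> nat pair_pre_digraph \<Rightarrow> (nat \<Rightarrow> nat) \<Rightarrow> bool" where
  "cycle_labelling n G g \<longleftrightarrow> bij_betw g {..<n} {..<n} \<and>
     parcs G = {(g a, g b) | a b. a < n \<and> b < n \<and> cycle_adjacent n a b}"

lemma circle_graph_labelling:
  assumes "circle_graph (network n s)"
  obtains g where "cycle_labelling n (network n s) g"
proof -
  obtain m f where m: "m \<ge> 3" and f: "bij_betw f {..<m} {..<n}"
    and arcs: "parcs (network n s) = (\<Union>i<m. {(f i, f (Suc i mod m)), (f (Suc i mod m), f i)})"
    using assms by (auto simp: circle_graph_def network_def)
  have [simp]: "m = n" using bij_betw_same_card[OF f] by simp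
  have adj: "cycle_adjacent n i (Suc i mod n) \<and> cycle_adjacent n (Suc i mod n) i" if "i < n" for i
    using that by (cases "Suc i = n") (auto simp: cycle_adjacent_def)
  have "parcs (network n s) = {(f a, f b) | a b. a < n \<and> b < n \<and> cycle_adjacent n a b}"
  proof (intro subset_antisym subsetI)
    fix e assume "e \<in> parcs (network n s)"
    then obtain i where "i < n" "e = (f i, f (Suc i mod n)) \<or> e = (f (Suc i mod n), f i)"
      by (auto simp: arcs)
    moreover from this have "Suc i mod n < n" by simp
    ultimately show "e \<in> {(f a, f b) | a b. a < n \<and> b < n \<and> cycle_adjacent n a b}"
      using adj[of i] by blast
  next
    fix e assume "e \<in> {(f a, f b) | a b. a < n \<and> b < n \<and> cycle_adjacent n a b}"
    then obtain a b where e: "e = (f a, f b)" "a < n" "b < n" "cycle_adjacent n a b" by blast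
    then consider "b = Suc a mod n" | "a = Suc b mod n"
      by (cases "Suc a = n"; cases "Suc b = n") (auto simp: cycle_adjacent_def)
    then show "e \<in> parcs (network n s)"
      using e by cases (auto simp: arcs)
  qed
  with f that show ?thesis by (simp add: cycle_labelling_def)
qed

lemma cycle_adjacent_rev:
  assumes "cycle_adjacent n a b" "a < n" "b < n"
  shows "cycle_adjacent n (n - 1 - a) (n - 1 - b)"
  using assms unfolding cycle_adjacent_def by (elim disjE conjE) (simp_all add: Suc_diff_Suc)

text \<open>Reversal exchanges positions \<open>0\<close> and \<open>n - 1\<close>, so an endpoint
  that pays for the edge between them can always be put at \<open>0\<close>.\<close>

lemma cycle_labelling_rev:
  assumes "cycle_labelling n G g"
  shows "cycle_labelling n G (\<lambda>a. g (n - 1 - a))"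
proof -
  have g: "bij_betw g {..<n} {..<n}"
    and arcs: "parcs G = {(g a, g b) | a b. a < n \<and> b < n \<and> cycle_adjacent n a b}"
    using assms by (auto simp: cycle_labelling_def)
  have "bij_betw (\<lambda>a. n - 1 - a) {..<n} {..<n}"
    by (rule bij_betw_byWitness[where f' = "\<lambda>a. n - 1 - a"]) auto
  from bij_betw_trans[OF this g] have "bij_betw (\<lambda>a. g (n - 1 - a)) {..<n} {..<n}"
    by (simp add: comp_def)
  moreover have "parcs G =
    {(g (n - 1 - a), g (n - 1 - b)) | a b. a < n \<and> b < n \<and> cycle_adjacent n a b}"
  proof (intro subset_antisym subsetI)
    fix e assume "e \<in> parcs G"
    then obtain a b where e: "e = (g a, g b)" "a < n" "b < n" "cycle_adjacent n a b"
      by (auto simp: arcs)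
    then have "e = (g (n - 1 - (n - 1 - a)), g (n - 1 - (n - 1 - b)))"
      "cycle_adjacent n (n - 1 - a) (n - 1 - b)" "n - 1 - a < n" "n - 1 - b < n"
      using cycle_adjacent_rev by simp_all
    then show "e \<in> {(g (n - 1 - a), g (n - 1 - b)) | a b. a < n \<and> b < n \<and> cycle_adjacent n a b}"
      by blast
  next
    fix e assume "e \<in> {(g (n - 1 - a), g (n - 1 - b)) | a b. a < n \<and> b < n \<and> cycle_adjacent n a b}"
    then obtain a b where e: "e = (g (n - 1 - a), g (n - 1 - b))" "a < n" "b < n"
      "cycle_adjacent n a b" by blast
    then have "cycle_adjacent n (n - 1 - a) (n - 1 - b)" "n - 1 - a < n" "n - 1 - b < n"
      using cycle_adjacent_rev by simp_all
    then show "e \<in> parcs G" using e(1) unfolding arcs by blast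
  qed
  ultimately show ?thesis by (simp add: cycle_labelling_def)
qed

lemma pverts_network [simp]: "pverts (network n s) = {..<n}"
  by (simp add: network_def)

lemma sym_parcs: "pair_graph G \<Longrightarrow> sym (parcs G)"
  using pair_sym_digraph.pair_sym_arcs[of G] pair_graph.axioms(2)[of G]
    pair_pseudo_graph.axioms(2)[of G] by (auto simp: symmetric_def)

lemma cycle_labelling_arc:
  assumes "cycle_labelling n G g" "a < n" "b < n" "cycle_adjacent n a b"
  shows "(g a, g b) \<in> parcs G"
  using assms by (auto simp: cycle_labelling_def)

lemma cycle_labelling_arc_iff:
  assumes "cycle_labelling n G g" "a < n" "b < n"
  shows "(g a, g b) \<in> parcs G \<longleftrightarrow> cycle_adjacent n a b"
proof
  assume "(g a, g b) \<in> parcs G"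
  then obtain a' b' where "g a = g a'" "g b = g b'" "a' < n" "b' < n" "cycle_adjacent n a' b'"
    using assms by (auto simp: cycle_labelling_def)
  moreover have "inj_on g {..<n}"
    using assms by (auto simp: cycle_labelling_def bij_betw_def)
  ultimately show "cycle_adjacent n a b"
    using assms by (metis inj_on_def lessThan_iff)
qed (use assms cycle_labelling_arc in blast)

text \<open>This \<open>\<phi>\<close> is the cyclic distance to position \<open>0\<close>, which
  serves as potential in all lower bounds for the original network.\<close>

lemma cycle_height:
  assumes "cycle_labelling n G g"
  obtains \<phi> :: "nat \<Rightarrow> int" where "\<And>a. a < n \<Longrightarrow> \<phi> (g a) = min (int a) (int n - int a)"
    "\<And>x y. (x, y) \<in> parcs G \<Longrightarrow> \<phi> y \<le> \<phi> x + 1"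
proof
  define p where "p = inv_into {..<n} g"
  have p: "p (g a) = a" if "a < n" for a
    using assms that by (auto simp: p_def cycle_labelling_def bij_betw_def)
  let ?\<phi> = "\<lambda>x. min (int (p x)) (int n - int (p x))"
  show "?\<phi> (g a) = min (int a) (int n - int a)" if "a < n" for a
    using p[OF that] by simp
  show "?\<phi> y \<le> ?\<phi> x + 1" if "(x, y) \<in> parcs G" for x y
  proof -
    obtain a b where "x = g a" "y = g b" "a < n" "b < n" "cycle_adjacent n a b"
      using assms \<open>(x, y) \<in> parcs G\<close> by (auto simp: cycle_labelling_def)
    then show ?thesis by (auto simp: p cycle_adjacent_def)
  qed
qed

lemma cycle_labelling_walk:
  assumes "pair_graph G" "cycle_labelling n G g" "a < n" "b < n"
  shows "(g a, g b) \<in> parcs G ^^ nat \<bar>int a - int b\<bar>"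
proof (rule relpow_path[OF sym_parcs[OF assms(1)] _ assms(3,4)])
  show "(g i, g (Suc i)) \<in> parcs G" if "Suc i < n" for i
    using cycle_labelling_arc[OF assms(2)] that by (simp add: cycle_adjacent_def)
qed

section \<open>Betweenness and closeness before and after the swap\<close>

lemma sum_inner_pairs_indicator:
  "(\<Sum>(a, b)\<in>inner_pairs n. if P a b then 1 else 0 :: real) =
    real (card {(a, b) \<in> inner_pairs n. P a b})"
proof -
  have "inner_pairs n \<inter> {(a, b). P a b} = {(a, b) \<in> inner_pairs n. P a b}"
    by auto
  then show ?thesis
    using finite_inner_pairs[of n] by (simp add: case_prod_unfold sum.If_cases Int_def)
qed

text \<open>If \<open>2 * \<bar>a - b\<bar> < n\<close>, the walk through consecutive positions
  beats every walk through \<open>g 0\<close>, and the dependency vanishes; the other pairs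
  contribute at most \<open>1\<close> each.\<close>

lemma sum_pair_dependency_le:
  assumes G: "pair_graph G" "pverts G = {..<n}" and cyc: "cycle_labelling n G g"
  shows "(\<Sum>(a, b)\<in>inner_pairs n. pair_dependency G (g 0) (g a) (g b)) \<le>
    real (card {(a, b) \<in> inner_pairs n. int n \<le> 2 * \<bar>int a - int b\<bar>})"
proof -
  interpret pair_graph G by (rule G(1))
  obtain \<phi> :: "nat \<Rightarrow> int" where \<phi>: "\<And>a. a < n \<Longrightarrow> \<phi> (g a) = min (int a) (int n - int a)"
    and lip: "\<And>x y. (x, y) \<in> parcs G \<Longrightarrow> \<phi> y \<le> \<phi> x + 1"
    using cycle_height[OF cyc] by blast
  have "pair_dependency G (g 0) (g a) (g b) \<le> (if int n \<le> 2 * \<bar>int a - int b\<bar> then 1 else 0)"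
    if "(a, b) \<in> inner_pairs n" for a b
  proof (cases "int n \<le> 2 * \<bar>int a - int b\<bar>")
    case True
    then show ?thesis by (simp add: pair_dependency_le_1)
  next
    case False
    have ab: "a < n" "b < n" "0 < a" "0 < b"
      using that by (auto simp: inner_pairs_def)
    then have "g a \<in> pverts G"
      using G(2) cyc by (auto simp: cycle_labelling_def bij_betw_def)
    \<comment> \<open>The heights of \<open>a\<close> and \<open>b\<close> add up to
      \<open>a + b\<close>, \<open>2 * n - a - b\<close> or \<open>n - \<bar>a - b\<bar>\<close>;
      only the last case depends on \<open>2 * \<bar>a - b\<bar> < n\<close>.\<close>
    moreover have "int (nat \<bar>int a - int b\<bar>) < (\<phi> (g a) - \<phi> (g 0)) + (\<phi> (g b) - \<phi> (g 0))"
      using ab False by (auto simp: \<phi> min_def abs_if)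
    ultimately have "pair_dependency G (g 0) (g a) (g b) = 0"
      using pair_dependency_eq_0[where \<phi> = \<phi>, OF cycle_labelling_walk[OF G(1) cyc ab(1,2)] _ lip] by blast
    then show ?thesis using False by simp
  qed
  then have "(\<Sum>(a, b)\<in>inner_pairs n. pair_dependency G (g 0) (g a) (g b)) \<le>
    (\<Sum>(a, b)\<in>inner_pairs n. if int n \<le> 2 * \<bar>int a - int b\<bar> then 1 else 0)"
    by (intro sum_mono) auto
  then show ?thesis by (simp only: sum_inner_pairs_indicator)
qed

lemma closeness_cycle_ge:
  assumes s: "strategy_combination n s" and cyc: "cycle_labelling n (network n s) g" and "0 < n"
  shows "ereal (\<Sum>j\<in>{1..<n}. real_of_int (min (int j) (int n - int j)) - 1) \<le> closeness n s (g 0)"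
proof -
  interpret pair_graph "network n s" by (rule pair_graph_network[OF s])
  obtain \<phi> :: "nat \<Rightarrow> int" where \<phi>: "\<And>a. a < n \<Longrightarrow> \<phi> (g a) = min (int a) (int n - int a)"
    and lip: "\<And>x y. (x, y) \<in> parcs (network n s) \<Longrightarrow> \<phi> y \<le> \<phi> x + 1"
    using cycle_height[OF cyc] by blast
  have "ereal (real_of_int (min (int j) (int n - int j)) - 1) \<le> graph_dist (network n s) (g 0) (g j) - 1"
    if "j < n" for j
    using ereal_minus_mono[OF graph_dist_ge[of \<phi> "g j" "g 0", OF lip] order_refl[of 1]] \<phi>[OF that]
      \<phi>[of 0] \<open>0 < n\<close> by (simp add: one_ereal_def)
  then have "(\<Sum>j\<in>{1..<n}. ereal (real_of_int (min (int j) (int n - int j)) - 1)) \<le>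
      (\<Sum>j\<in>{1..<n}. graph_dist (network n s) (g 0) (g j) - 1)"
    by (intro sum_mono) auto
  then show ?thesis
    using closeness_reindex[of g n s] cyc \<open>0 < n\<close> by (simp add: cycle_labelling_def)
qed

lemma closeness_le:
  assumes s: "strategy_combination n s" and g: "bij_betw g {..<n} {..<n}" and "0 < n"
    and walk: "\<And>j. 0 < j \<Longrightarrow> j < n \<Longrightarrow> \<exists>k. (g 0, g j) \<in> parcs (network n s) ^^ k \<and> int k \<le> l j"
  shows "closeness n s (g 0) \<le> ereal (\<Sum>j\<in>{1..<n}. real_of_int (l j) - 1)"
proof -
  interpret pair_graph "network n s" by (rule pair_graph_network[OF s])
  have "graph_dist (network n s) (g 0) (g j) - 1 \<le> ereal (real_of_int (l j) - 1)"
    if "0 < j" "j < n" for j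
  proof -
    from walk[OF that] obtain k
      where k: "(g 0, g j) \<in> parcs (network n s) ^^ k" "int k \<le> l j" by blast
    have "g 0 \<in> pverts (network n s)"
      using g \<open>0 < n\<close> by (auto simp: bij_betw_def)
    from graph_dist_le[OF k(1) this] have "graph_dist (network n s) (g 0) (g j) \<le> ereal (real k)" .
    also have "\<dots> \<le> ereal (real_of_int (l j))"
      using k(2) by simp
    finally show ?thesis
      using ereal_minus_mono[OF _ order_refl[of 1]] by (fastforce simp: one_ereal_def)
  qed
  then have "(\<Sum>j\<in>{1..<n}. graph_dist (network n s) (g 0) (g j) - 1) \<le>
      (\<Sum>j\<in>{1..<n}. ereal (real_of_int (l j) - 1))"
    by (intro sum_mono) auto
  then show ?thesis
    using closeness_reindex[OF g \<open>0 < n\<close>, of s] by simp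
qed

lemma relpow_step_between:
  assumes "(x, y) \<in> R ^^ k" "(y, z) \<in> R" "(z, w) \<in> R ^^ l"
  shows "(x, w) \<in> R ^^ (k + 1 + l)"
proof -
  have "(x, z) \<in> R ^^ (k + 1)"
    using relpow_Suc_I[OF assms(1,2)] by simp
  from relpow_trans[OF this assms(3)] show ?thesis .
qed

text \<open>From the smaller position go down to \<open>0\<close>, take the chord to
  \<open>w\<close> and continue to the larger one. A walk avoiding \<open>g 0\<close> changes
  position by at most \<open>1\<close> per arc, so it needs at least
  \<open>\<bar>a - b\<bar>\<close> arcs. If the first walk is shorter than that, the dependency is
  \<open>1\<close>.\<close>

lemma sum_pair_dependency_ge:
  assumes G: "pair_graph G" "pverts G = {..<n}" and g: "bij_betw g {..<n} {..<n}"
    and path: "\<And>i. Suc i < n \<Longrightarrow> (g i, g (Suc i)) \<in> parcs G"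
    and chord: "(g 0, g w) \<in> parcs G" "w < n"
    and inner: "\<And>a b. a < n \<Longrightarrow> b < n \<Longrightarrow> a \<noteq> 0 \<Longrightarrow> b \<noteq> 0 \<Longrightarrow> (g a, g b) \<in> parcs G \<Longrightarrow>
      \<bar>int a - int b\<bar> \<le> 1"
  shows "real (card {(a, b) \<in> inner_pairs n.
      int (min a b) + 1 + \<bar>int (max a b) - int w\<bar> < \<bar>int a - int b\<bar>}) \<le>
    (\<Sum>(a, b)\<in>inner_pairs n. pair_dependency G (g 0) (g a) (g b))"
proof -
  interpret pair_graph G by (rule G(1))
  define p where "p = inv_into {..<n} g"
  have p: "p (g a) = a" if "a < n" for a
    using g that by (auto simp: p_def bij_betw_def)
  have lip: "\<bar>int (p x) - int (p y)\<bar> \<le> 1"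
    if "(x, y) \<in> parcs G" "x \<noteq> g 0" "y \<noteq> g 0" for x y
  proof -
    have "x \<in> g ` {..<n}" "y \<in> g ` {..<n}"
      using in_arcsD1[OF that(1)] in_arcsD2[OF that(1)] G(2) g by (auto simp: bij_betw_def)
    then obtain a b where "x = g a" "y = g b" "a < n" "b < n" by blast
    then show ?thesis using that inner[of a b] p by (cases "a = 0"; cases "b = 0") auto
  qed
  note walk = relpow_path[where g = g and n = n, OF sym_parcs[OF G(1)] path]
  have "(if int (min a b) + 1 + \<bar>int (max a b) - int w\<bar> < \<bar>int a - int b\<bar> then 1 else 0)
      \<le> pair_dependency G (g 0) (g a) (g b)"
    if "(a, b) \<in> inner_pairs n" for a b
  proof (cases "int (min a b) + 1 + \<bar>int (max a b) - int w\<bar> < \<bar>int a - int b\<bar>")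
    case True
    have ab: "a < n" "b < n" "0 < n" using that by (auto simp: inner_pairs_def)
    then have ga: "g a \<in> pverts G"
      using G(2) g by (auto simp: bij_betw_def)
    have "pair_dependency G (g 0) (g a) (g b) = 1"
    proof (cases "a < b")
      case less: True
      have "(g a, g b) \<in> parcs G ^^ (nat \<bar>int a - int 0\<bar> + 1 + nat \<bar>int w - int b\<bar>)"
        using walk[of a 0] walk[of w b] ab chord by (intro relpow_step_between) auto
      then show ?thesis
        by (rule pair_dependency_eq_1[OF _ ga, where \<phi> = "\<lambda>x. int (p x)"])
          (use lip True less ab in \<open>force simp: p\<close>)+
    next
      \<comment> \<open>The same walk is traversed backwards; positions now decrease from
        \<open>a\<close> to \<open>b\<close>, so the potential is the negated position.\<close>
      case False
      have "(g w, g 0) \<in> parcs G"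
        using chord sym_parcs[OF G(1)] by (auto dest: symD)
      then have "(g a, g b) \<in> parcs G ^^ (nat \<bar>int a - int w\<bar> + 1 + nat \<bar>int 0 - int b\<bar>)"
        using walk[of a w] walk[of 0 b] ab chord by (intro relpow_step_between) auto
      then show ?thesis
        by (rule pair_dependency_eq_1[OF _ ga, where \<phi> = "\<lambda>x. - int (p x)"])
          (use lip True False ab in \<open>force simp: p\<close>)+
    qed
    then show ?thesis by simp
  qed (simp add: pair_dependency_nonneg)
  then have "(\<Sum>(a, b)\<in>inner_pairs n.
      if int (min a b) + 1 + \<bar>int (max a b) - int w\<bar> < \<bar>int a - int b\<bar> then 1 else 0)
    \<le> (\<Sum>(a, b)\<in>inner_pairs n. pair_dependency G (g 0) (g a) (g b))"
    by (intro sum_mono) auto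
  then show ?thesis by (simp only: sum_inner_pairs_indicator)
qed

section \<open>The two improving deviations\<close>

lemma cost_less:
  assumes "0 \<le> b" "0 < c" "B' \<le> B" "C' \<le> ereal x" "ereal y \<le> C" "x < y"
  shows "ereal (k + b * B') + ereal c * C' < ereal (k + b * B) + ereal c * C"
proof -
  have "ereal (k + b * B') + ereal c * C' \<le> ereal (k + b * B') + ereal c * ereal x"
    using assms by (intro add_left_mono ereal_mult_left_mono) auto
  \<comment> \<open>Strictness is obtained between the real bounds, since adding
    \<open>\<infinity>\<close> would destroy it.\<close>
  also have "\<dots> < ereal (k + b * B) + ereal c * ereal y"
    using assms by (simp add: add_le_less_mono mult_left_mono)
  also have "\<dots> \<le> ereal (k + b * B) + ereal c * C"
    using assms by (intro add_left_mono ereal_mult_left_mono) auto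
  finally show ?thesis .
qed

lemma swap_decreases_cost:
  assumes s: "strategy_combination n s" and cyc: "cycle_labelling n (network n s) g"
    and n: "n \<ge> 20" and bc: "0 \<le> b" "0 < c"
    and own: "g (n - 1) \<in> s (g 0)" "g 0 \<notin> s (g (n - 1))"
  shows "\<exists>t\<in>strategies n (g 0). cost n b c (s(g 0 := t)) (g 0) < cost n b c s (g 0)"
proof
  define t where "t = insert (g (n - 4)) (s (g 0) - {g (n - 1)})"
  let ?s' = "s(g 0 := t)"
  have g: "bij_betw g {..<n} {..<n}"
    using cyc by (simp add: cycle_labelling_def)
  have inj: "g a = g b \<longleftrightarrow> a = b" if "a < n" "b < n" for a b
    using g that by (auto simp: bij_betw_def inj_on_def)
  have img: "g a < n" if "a < n" for a
    using g that by (auto simp: bij_betw_def)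
  have su: "s (g 0) \<subseteq> {..<n} - {g 0}"
    using s img[of 0] n by (auto simp: strategy_combination_def strategies_def)
  have arc: "(g a, g b) \<in> parcs (network n s) \<longleftrightarrow> cycle_adjacent n a b" if "a < n" "b < n" for a b
    using cycle_labelling_arc_iff[OF cyc that] .
  show t: "t \<in> strategies n (g 0)"
    using su n inj[of "n - 4" 0] img[of "n - 4"] by (auto simp: t_def strategies_def)
  have s': "strategy_combination n ?s'"
    using s t by (auto simp: strategy_combination_def)
  \<comment> \<open>Positions \<open>0\<close> and \<open>n - 4\<close> are not adjacent in the
    cycle. Hence the inserted channel is new and the number of channels stays the same.\<close>
  have "g (n - 4) \<notin> s (g 0)"
  proof
    assume "g (n - 4) \<in> s (g 0)"
    then have "(g 0, g (n - 4)) \<in> parcs (network n s)"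
      using img n by (auto simp: network_def)
    then show False using arc[of 0 "n - 4"] n by (auto simp: cycle_adjacent_def)
  qed
  moreover have "finite (s (g 0))"
    using su finite_subset by blast
  moreover have "card (s (g 0)) > 0"
    using own(1) \<open>finite (s (g 0))\<close> by (auto simp: card_gt_0_iff)
  ultimately have card: "card t = card (s (g 0))"
    using own(1) by (simp add: t_def)
  \<comment> \<open>Only arcs between \<open>g 0\<close> and \<open>g (n - 1)\<close> can be lost.
    The condition on \<open>x\<close> is coarser, but holds for every arc from position
    \<open>i\<close> to \<open>Suc i\<close>.\<close>
  have keep: "(x, y) \<in> parcs (network n ?s')"
    if "(x, y) \<in> parcs (network n s)" "x \<noteq> g (n - 1)" "\<not> (x = g 0 \<and> y = g (n - 1))" for x y
    using that by (cases "x = g 0"; cases "y = g 0") (auto simp: network_def t_def)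
  have path: "(g i, g (Suc i)) \<in> parcs (network n ?s')" if "Suc i < n" for i
  proof -
    have "(g i, g (Suc i)) \<in> parcs (network n s)"
      using arc[of i "Suc i"] that by (simp add: cycle_adjacent_def)
    moreover have "g i \<noteq> g (n - 1)" "\<not> (g i = g 0 \<and> g (Suc i) = g (n - 1))"
    proof -
      have "i < n" "n - 1 < n" "0 < n" "i \<noteq> n - 1" "\<not> (i = 0 \<and> Suc i = n - 1)"
        using that n by linarith+
      with that show "g i \<noteq> g (n - 1)" "\<not> (g i = g 0 \<and> g (Suc i) = g (n - 1))"
        by (simp_all only: inj not_False_eq_True)
    qed
    ultimately show ?thesis by (rule keep)
  qed
  have chord: "(g 0, g (n - 4)) \<in> parcs (network n ?s')"
    using img n by (auto simp: network_def t_def)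
  have inner: "\<bar>int a - int b\<bar> \<le> 1"
    if ab: "a < n" "b < n" "a \<noteq> 0" "b \<noteq> 0" "(g a, g b) \<in> parcs (network n ?s')" for a b
  proof -
    have "(g a, g b) \<in> parcs (network n s)"
      using ab inj[of a 0] inj[of b 0] by (auto simp: network_def)
    then show ?thesis using arc[OF ab(1,2)] ab by (auto simp: cycle_adjacent_def)
  qed
  note walk = relpow_path[where g = g and n = n, OF sym_parcs[OF pair_graph_network[OF s']] path]
  have "closeness n ?s' (g 0) \<le>
      ereal (\<Sum>j\<in>{1..<n}. real_of_int (min (int j) (1 + \<bar>int j - int (n - 4)\<bar>)) - 1)"
  proof (rule closeness_le[OF s' g])
    fix j assume "0 < j" "j < n"
    have direct: "(g 0, g j) \<in> parcs (network n ?s') ^^ j"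
      using walk[of 0 j] \<open>j < n\<close> by simp
    have detour: "(g 0, g j) \<in> parcs (network n ?s') ^^ (0 + 1 + nat \<bar>int (n - 4) - int j\<bar>)"
      using walk[of "n - 4" j] \<open>j < n\<close> chord by (intro relpow_step_between) auto
    show "\<exists>k. (g 0, g j) \<in> parcs (network n ?s') ^^ k \<and>
        int k \<le> min (int j) (1 + \<bar>int j - int (n - 4)\<bar>)"
    proof (cases "int j \<le> 1 + \<bar>int j - int (n - 4)\<bar>")
      case True
      with direct show ?thesis by auto
    next
      case False
      then have "int (0 + 1 + nat \<bar>int (n - 4) - int j\<bar>) \<le> min (int j) (1 + \<bar>int j - int (n - 4)\<bar>)"
        by linarith
      with detour show ?thesis by blast
    qed
  qed (use n in simp)
  \<comment> \<open>The dependency sum before the swap is at most the first cardinality in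
    \<open>card_inner_pairs_le\<close>, and the second is at most the sum afterwards; betweenness
    subtracts these sums.\<close>
  moreover have "betweenness n ?s' (g 0) \<le> betweenness n s (g 0)"
    using sum_pair_dependency_le[OF pair_graph_network[OF s] pverts_network cyc]
      sum_pair_dependency_ge[OF pair_graph_network[OF s'] pverts_network g path chord _ inner]
      card_inner_pairs_le[OF n] n
    unfolding betweenness_reindex[OF g order_less_le_trans[OF zero_less_numeral n]] by linarith
  moreover have "ereal (\<Sum>j\<in>{1..<n}. real_of_int (min (int j) (int n - int j)) - 1) \<le>
      closeness n s (g 0)"
    using closeness_cycle_ge[OF s cyc] n by simp
  moreover have "(\<Sum>j\<in>{1..<n}. real_of_int (min (int j) (1 + \<bar>int j - int (n - 4)\<bar>)) - 1) <
      (\<Sum>j\<in>{1..<n}. real_of_int (min (int j) (int n - int j)) - 1)"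
    using sum_cycle_distances_gt[OF n]
    unfolding sum_subtractf of_int_sum[symmetric] by linarith
  ultimately show "cost n b c ?s' (g 0) < cost n b c s (g 0)"
    unfolding cost_def using card bc by (simp only: fun_upd_same) (rule cost_less)
qed

text \<open>The edge survives because its other endpoint pays as well, so only the channel count
  changes.\<close>

lemma drop_decreases_cost:
  assumes s: "strategy_combination n s" and cyc: "cycle_labelling n (network n s) g" and n: "0 < n"
    and own: "g (n - 1) \<in> s (g 0)" "g 0 \<in> s (g (n - 1))"
  shows "\<exists>t\<in>strategies n (g 0). cost n b c (s(g 0 := t)) (g 0) < cost n b c s (g 0)"
proof
  define t where "t = s (g 0) - {g (n - 1)}"
  have g: "bij_betw g {..<n} {..<n}"
    using cyc by (simp add: cycle_labelling_def)
  have "g 0 < n" "g (n - 1) < n"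
    using g n by (auto simp: bij_betw_def)
  then have su: "s (g 0) \<subseteq> {..<n} - {g 0}" "g 0 \<noteq> g (n - 1)"
    using s own by (auto simp: strategy_combination_def strategies_def)
  then show "t \<in> strategies n (g 0)"
    by (auto simp: strategies_def t_def)
  have net: "network n (s(g 0 := t)) = network n s"
  proof -
    have "y \<in> (s(g 0 := t)) x \<or> x \<in> (s(g 0 := t)) y \<longleftrightarrow> y \<in> s x \<or> x \<in> s y" for x y
      using own su(2) by (cases "x = g 0"; cases "y = g 0") (auto simp: t_def)
    then show ?thesis by (simp add: network_def)
  qed
  \<comment> \<open>An infinite closeness would swallow the saved channel, so finiteness is
    established first, by a crude bound from walks of length \<open>j\<close>.\<close>
  have "closeness n s (g 0) \<le> ereal (\<Sum>j\<in>{1..<n}. real_of_int (int j) - 1)"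
    using cycle_labelling_walk[OF pair_graph_network[OF s] cyc, of 0] n
    by (intro closeness_le[OF s g n]) fastforce
  with closeness_cycle_ge[OF s cyc n] obtain r where r: "closeness n s (g 0) = ereal r"
    by (cases "closeness n s (g 0)") auto
  have "finite (s (g 0))"
    using su(1) finite_subset by blast
  then have card: "card t < card (s (g 0))"
    using own(1) by (intro psubset_card_mono) (auto simp: t_def)
  have "betweenness n (s(g 0 := t)) = betweenness n s" "closeness n (s(g 0 := t)) = closeness n s"
    by (simp_all add: betweenness_def closeness_def net fun_eq_iff)
  then show "cost n b c (s(g 0 := t)) (g 0) < cost n b c s (g 0)"
    using r card by (simp add: cost_def)
qed

theorem theorem6:
  shows "\<exists>N>0. \<forall>n\<ge>N. \<forall>b c :: real. b \<ge> 0 \<longrightarrow> c > 0 \<longrightarrow>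
    (\<forall>s. strategy_combination n s \<longrightarrow> circle_graph (network n s) \<longrightarrow>
      \<not> nash_equilibrium n b c s)"
proof (intro exI[of _ 20] conjI allI impI notI)
  fix n b c s
  \<comment> \<open>The bound \<open>20\<close> comes from the counting lemmas, where it ensures for
    instance that \<open>3 + h \<le> n - 4\<close>.\<close>
  assume n: "20 \<le> n" and bc: "(0 :: real) \<le> b" "(0 :: real) < c"
    and s: "strategy_combination n s" and circle: "circle_graph (network n s)"
    and nash: "nash_equilibrium n b c s"
  obtain g where g: "cycle_labelling n (network n s) g"
    using circle_graph_labelling[OF circle] .
  obtain h where h: "cycle_labelling n (network n s) h" and own: "h (n - 1) \<in> s (h 0)"
  proof (cases "g (n - 1) \<in> s (g 0)")
    case False
    have "(g 0, g (n - 1)) \<in> parcs (network n s)"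
      using cycle_labelling_arc[OF g, of 0 "n - 1"] n by (simp add: cycle_adjacent_def)
    with False have "g 0 \<in> s (g (n - 1))"
      by (auto simp: network_def)
    then show ?thesis using that[OF cycle_labelling_rev[OF g]] by simp
  qed (use that g in blast)
  have "\<exists>t\<in>strategies n (h 0). cost n b c (s(h 0 := t)) (h 0) < cost n b c s (h 0)"
  proof (cases "h 0 \<in> s (h (n - 1))")
    case True
    show ?thesis using drop_decreases_cost[OF s h _ own True] n by simp
  next
    case False
    show ?thesis using swap_decreases_cost[OF s h n bc own False] .
  qed
  moreover have "h 0 < n"
    using h n by (auto simp: cycle_labelling_def bij_betw_def)
  ultimately show False using nash by (auto simp: nash_equilibrium_def)
qed simp

end
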